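(* Let $s,t$ be real numbers with $s\neq0$, $t\neq0$, $s^2+4t\neq0$, and let $q=\varphi'_{s,t}/\varphi_{s,t}$. For all integers $n\geq1$, \[ D_{\varphi,\varphi'}^{n}\left(\frac{1}{1-x}\right)=\frac{\{n\}_{s,t}!}{(\varphi_{s,t}^n x;q)_{n+1}}. \]
   Context: The generalized Fibonacci polynomials $\{n\}_{s,t}$ are defined by $\{0\}_{s,t}=0$, $\{1\}_{s,t}=1$, $\{n+2\}_{s,t}=s\{n+1\}_{s,t}+t\{n\}_{s,t}$, and $\{n\}_{s,t}!=\{1\}_{s,t}\cdots\{n\}_{s,t}$. Set $\varphi_{s,t}=\frac{s+\sqrt{s^2+4t}}{2}$, $\varphi'_{s,t}=\frac{s-\sqrt{s^2+4t}}{2}$. The $(\varphi,\varphi')$-derivative of a function $f$ is $(D_{\varphi,\varphi'}f)(x)=\frac{f(\varphi_{s,t}x)-f(\varphi'_{s,t}x)}{(\varphi_{s,t}-\varphi'_{s,t})x}$ for $x\neq0$ and $f'(0)$ for $x=0$; $D^n_{\varphi,\varphi'}$ denotes its $n$-fold iterate. The $q$-Pochhammer symbol is $(a;q)_m=\prod_{k=0}^{m-1}(1-aq^k)$. *)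

theory Defs
  imports "HOL-Analysis.Analysis"
begin

fun gfib :: "real \<Rightarrow> real \<Rightarrow> nat \<Rightarrow> real" where
  "gfib s t 0 = 0"
| "gfib s t (Suc 0) = 1"
| "gfib s t (Suc (Suc n)) = s * gfib s t (Suc n) + t * gfib s t n"

definition gfib_fact :: "real \<Rightarrow> real \<Rightarrow> nat \<Rightarrow> real" where
  "gfib_fact s t n = (\<Prod>k=1..n. gfib s t k)"

(* The discriminant s^2 + 4 t may be negative, so the roots are complex; the real function sqrt
   would give - sqrt \<bar>s^2 + 4 t\<bar> there.  For a real argument, csqrt is the usual nonnegative
   square root or \<i> times the square root of the absolute value. *)
definition phi :: "real \<Rightarrow> real \<Rightarrow> complex" where
  "phi s t = (of_real s + csqrt (of_real (s\<^sup>2 + 4 * t))) / 2"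

definition phi' :: "real \<Rightarrow> real \<Rightarrow> complex" where
  "phi' s t = (of_real s - csqrt (of_real (s\<^sup>2 + 4 * t))) / 2"

definition phi_deriv :: "real \<Rightarrow> real \<Rightarrow> (complex \<Rightarrow> complex) \<Rightarrow> complex \<Rightarrow> complex" where
  "phi_deriv s t f x =
    (if x = 0 then deriv f 0
     else (f (phi s t * x) - f (phi' s t * x)) / ((phi s t - phi' s t) * x))"

definition qpoch :: "complex \<Rightarrow> complex \<Rightarrow> nat \<Rightarrow> complex" where
  "qpoch a q m = (\<Prod>k<m. 1 - a * q ^ k)"

end

theory Submission imports Defs begin

text \<open>
  Write \<open>a\<close>, \<open>b\<close> for the two roots. Since \<open>q = b / a\<close>, the denominator on the right is
  \<open>P\<^sub>n(x) = \<Prod>k\<le>n. 1 - a\<^sup>n\<^sup>-\<^sup>k b\<^sup>k x\<close>, and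
  \<open>P\<^sub>n\<^sub>+\<^sub>1(x) = (1 - b\<^sup>n\<^sup>+\<^sup>1 x) P\<^sub>n(a x) = (1 - a\<^sup>n\<^sup>+\<^sup>1 x) P\<^sub>n(b x)\<close>. By induction,
  one more derivative produces the factor \<open>(a\<^sup>n\<^sup>+\<^sup>1 - b\<^sup>n\<^sup>+\<^sup>1) / (a - b)\<close>, which is
  Binet's formula for the next Fibonacci polynomial. At \<open>x = 0\<close> the same factor appears as
  \<open>- P\<^sub>n'(0) = \<Sum>k\<le>n. a\<^sup>n\<^sup>-\<^sup>k b\<^sup>k\<close>.
\<close>

text \<open>Free of the quotient \<open>b / a\<close>: the exponents of \<open>a\<close> and
  \<open>b\<close> add up to \<open>n\<close>, so the roots enter symmetrically.\<close>

definition root_prod :: "complex \<Rightarrow> complex \<Rightarrow> nat \<Rightarrow> complex \<Rightarrow> complex" where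
  "root_prod a b n x = (\<Prod>k<Suc n. 1 - b ^ k * a ^ (n - k) * x)"

lemma qpoch_eq_root_prod:
  assumes "a \<noteq> 0"
  shows "qpoch (a ^ n * x) (b / a) (n + 1) = root_prod a b n x"
  unfolding qpoch_def root_prod_def
proof (rule prod.cong)
  fix k assume "k \<in> {..<Suc n}"
  then have "a ^ n = a ^ k * a ^ (n - k)"
    by (simp flip: power_add)
  then show "1 - a ^ n * x * (b / a) ^ k = 1 - b ^ k * a ^ (n - k) * x"
    using assms by (simp add: power_divide field_simps)
qed simp

text \<open>Split off the last factor; each other one has a spare power of \<open>a\<close>, which
  moves into the argument. Splitting off the first factor instead moves a power of
  \<open>b\<close>.\<close>

lemma root_prod_Suc_left:
  "root_prod a b (Suc n) x = (1 - b ^ Suc n * x) * root_prod a b n (a * x)"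
proof -
  have "(\<Prod>k<Suc n. 1 - b ^ k * a ^ (Suc n - k) * x) = root_prod a b n (a * x)"
    unfolding root_prod_def by (rule prod.cong) (auto simp: Suc_diff_le less_Suc_eq_le mult_ac)
  moreover have "root_prod a b (Suc n) x
      = (\<Prod>k<Suc n. 1 - b ^ k * a ^ (Suc n - k) * x) * (1 - b ^ Suc n * x)"
    unfolding root_prod_def by (subst prod.lessThan_Suc) simp
  ultimately show ?thesis by simp
qed

lemma root_prod_Suc_right:
  "root_prod a b (Suc n) x = (1 - a ^ Suc n * x) * root_prod a b n (b * x)"
  unfolding root_prod_def by (subst prod.lessThan_Suc_shift) (simp add: mult_ac)

lemma root_prod_0 [simp]: "root_prod a b n 0 = 1"
  by (simp add: root_prod_def)

lemma has_field_derivative_root_prod_0: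
  "(root_prod a b n has_field_derivative - (\<Sum>k<Suc n. b ^ k * a ^ (n - k))) (at 0)"
proof -
  have "((\<lambda>x. \<Prod>k<Suc n. 1 - b ^ k * a ^ (n - k) * x) has_field_derivative
      (\<Sum>k<Suc n. - (b ^ k * a ^ (n - k)) *
        (\<Prod>j\<in>{..<Suc n} - {k}. 1 - b ^ j * a ^ (n - j) * 0))) (at 0)"
    by (rule has_field_derivative_prod) (auto intro!: derivative_eq_intros)
  then show ?thesis
    unfolding root_prod_def by (simp add: sum_negf)
qed

text \<open>Makes the closed form valid on a whole neighbourhood of 0, as the ordinary derivative
  there requires.\<close>

lemma eventually_root_prod_nonzero: "eventually (\<lambda>x. root_prod a b n x \<noteq> 0) (nhds 0)"
proof -
  have "isCont (root_prod a b n) 0"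
    using has_field_derivative_root_prod_0 DERIV_isCont by blast
  then have "(root_prod a b n \<longlongrightarrow> root_prod a b n 0) (nhds 0)"
    unfolding isCont_def tendsto_at_iff_tendsto_nhds .
  then show ?thesis
    by (rule tendsto_imp_eventually_ne) simp
qed

lemma phi_mult_phi': "phi s t * phi' s t = - of_real t"
proof -
  have "phi s t * phi' s t = (of_real s ^ 2 - csqrt (of_real (s\<^sup>2 + 4 * t)) ^ 2) / 4"
    unfolding phi_def phi'_def by (simp add: power2_eq_square algebra_simps)
  then show ?thesis
    by (simp add: power2_csqrt)
qed

lemma phi_add_phi': "phi s t + phi' s t = of_real s"
  unfolding phi_def phi'_def by (simp add: field_simps)

lemma phi_neq_phi':
  assumes "s\<^sup>2 + 4 * t \<noteq> 0"
  shows "phi s t \<noteq> phi' s t"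
proof -
  have "phi s t - phi' s t = csqrt (of_real (s\<^sup>2 + 4 * t))"
    unfolding phi_def phi'_def by (simp add: field_simps)
  moreover have "csqrt (of_real (s\<^sup>2 + 4 * t)) \<noteq> 0"
    using assms by (simp only: csqrt_eq_0 of_real_eq_0_iff not_False_eq_True)
  ultimately show ?thesis by auto
qed

text \<open>By Vieta both roots satisfy \<open>X^2 = s * X + t\<close>, so both sides obey the same
  two-step recurrence.\<close>

lemma gfib_Binet:
  "(phi s t - phi' s t) * of_real (gfib s t n) = phi s t ^ n - phi' s t ^ n"
proof (induction n rule: induct_nat_012)
  case (ge2 n)
  define a b where "a = phi s t" and "b = phi' s t"
  have sum: "of_real s = a + b" and prod: "of_real t = - (a * b)"
    unfolding a_def b_def phi_add_phi' phi_mult_phi' by simp_all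
  have "(a - b) * of_real (gfib s t (Suc (Suc n)))
      = (a + b) * ((a - b) * of_real (gfib s t (Suc n)))
        - a * b * ((a - b) * of_real (gfib s t n))"
    by (simp add: sum prod algebra_simps)
  also have "\<dots> = (a + b) * (a ^ Suc n - b ^ Suc n) - a * b * (a ^ n - b ^ n)"
    unfolding a_def b_def ge2.IH ..
  also have "\<dots> = a ^ Suc (Suc n) - b ^ Suc (Suc n)"
    by (simp add: algebra_simps)
  finally show ?case unfolding a_def b_def .
qed simp_all

lemma gfib_fact_Suc: "gfib_fact s t (Suc n) = gfib_fact s t n * gfib s t (Suc n)"
  by (simp add: gfib_fact_def)

lemma funpow_phi_deriv_geometric:
  assumes "s\<^sup>2 + 4 * t \<noteq> 0" and "root_prod (phi s t) (phi' s t) n x \<noteq> 0"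
  shows "(phi_deriv s t ^^ n) (\<lambda>z. 1 / (1 - z)) x
    = of_real (gfib_fact s t n) / root_prod (phi s t) (phi' s t) n x"
  using assms(2)
\<comment> \<open>The point must vary: the next derivative samples the iterate at
  \<open>a * x\<close> and \<open>b * x\<close>, or near 0.\<close>
proof (induction n arbitrary: x)
  case 0
  show ?case by (simp add: gfib_fact_def root_prod_def)
next
  case (Suc n)
  define a b where "a = phi s t" and "b = phi' s t"
  define g where "g = (phi_deriv s t ^^ n) (\<lambda>z. 1 / (1 - z))"
  define F :: complex where "F = of_real (gfib_fact s t n)"
  define G :: complex where "G = of_real (gfib s t (Suc n))"
  let ?P = "root_prod a b"
  have ab: "a \<noteq> b"
    using phi_neq_phi'[OF assms(1)] by (simp add: a_def b_def)
  have Binet: "(a - b) * G = a ^ Suc n - b ^ Suc n"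
    unfolding a_def b_def G_def by (rule gfib_Binet)
  have IH: "g z = F / ?P n z" if "?P n z \<noteq> 0" for z
    using Suc.IH[of z] that by (simp add: g_def F_def a_def b_def)
  have nz: "?P (Suc n) x \<noteq> 0"
    using Suc.prems by (simp add: a_def b_def)
  have "phi_deriv s t g x = F * G / ?P (Suc n) x"
  proof (cases "x = 0")
    case True
    \<comment> \<open>The geometric sum telescopes to the right-hand side of Binet's
      formula.\<close>
    have "(a - b) * (\<Sum>k<Suc n. b ^ k * a ^ (n - k)) = (a - b) * G"
      unfolding Binet using diff_power_eq_sum[of b n a] by (simp add: algebra_simps)
    then have sum: "(\<Sum>k<Suc n. b ^ k * a ^ (n - k)) = G"
      using ab by simp
    \<comment> \<open>Quotient rule with \<open>?P n 0 = 1\<close> and derivative \<open>- G\<close>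
      of the denominator.\<close>
    have "((\<lambda>z. F / ?P n z) has_field_derivative F * G) (at 0)"
      using DERIV_divide[OF DERIV_const has_field_derivative_root_prod_0[of a b n]]
      unfolding sum by simp
    moreover have "eventually (\<lambda>z. g z = F / ?P n z) (nhds 0)"
      using eventually_root_prod_nonzero by eventually_elim (rule IH)
    ultimately have "deriv g 0 = F * G"
      by (metis DERIV_imp_deriv deriv_cong_ev)
    then show ?thesis
      using True by (simp add: phi_deriv_def)
  next
    case False
    have left: "?P (Suc n) x = (1 - b ^ Suc n * x) * ?P n (a * x)"
      by (rule root_prod_Suc_left)
    have right: "?P (Suc n) x = (1 - a ^ Suc n * x) * ?P n (b * x)"
      by (rule root_prod_Suc_right)
    \<comment> \<open>By \<open>left\<close>, \<open>nz\<close> forces \<open>?P n (a * x)\<close>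
      to be nonzero, so \<open>IH\<close> applies; expanding the fraction gives both samples the
      same denominator.\<close>
    have "g (a * x) = F * (1 - b ^ Suc n * x) / ?P (Suc n) x"
      using nz IH[of "a * x"] unfolding left by simp
    moreover have "g (b * x) = F * (1 - a ^ Suc n * x) / ?P (Suc n) x"
      using nz IH[of "b * x"] unfolding right by simp
    ultimately have "g (a * x) - g (b * x) = F * ((a ^ Suc n - b ^ Suc n) * x) / ?P (Suc n) x"
      by (simp add: algebra_simps flip: diff_divide_distrib)
    also have "\<dots> = (F * G / ?P (Suc n) x) * ((a - b) * x)"
      unfolding Binet[symmetric] by (simp add: mult_ac)
    finally show ?thesis
      using False ab by (simp add: phi_deriv_def a_def b_def)
  qed
  then show ?case
    by (simp add: g_def F_def G_def a_def b_def gfib_fact_Suc)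
qed

theorem theorem6:
  fixes s t :: real and q x :: complex and n :: nat
  assumes "s \<noteq> 0" and "t \<noteq> 0" and "s\<^sup>2 + 4 * t \<noteq> 0"
    and "q = phi' s t / phi s t"
    and "n \<ge> 1"
    and "qpoch (phi s t ^ n * x) q (n + 1) \<noteq> 0"
  shows "(phi_deriv s t ^^ n) (\<lambda>z. 1 / (1 - z)) x
    = of_real (gfib_fact s t n) / qpoch (phi s t ^ n * x) q (n + 1)"
proof -
  \<comment> \<open>The product of the roots is \<open>- t\<close>.\<close>
  have "phi s t \<noteq> 0"
    using phi_mult_phi'[of s t] \<open>t \<noteq> 0\<close> by auto
  then have "qpoch (phi s t ^ n * x) q (n + 1) = root_prod (phi s t) (phi' s t) n x"
    unfolding \<open>q = phi' s t / phi s t\<close> by (rule qpoch_eq_root_prod)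
  then show ?thesis
    using funpow_phi_deriv_geometric[OF \<open>s\<^sup>2 + 4 * t \<noteq> 0\<close>] assms(6) by simp
qed

end
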